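(* Let $P_1,\dots,P_k\subseteq\mathbb{R}^n$ be nonempty polyhedra and $F_j:\mathbb{R}^n\to\mathbb{R}^n$, $j=1,\dots,k$, be affine operators such that $(F_1,P_1),\dots,(F_k,P_k)$ is a compatible collection. Let $F=\bigcup_{j=1}^kF_j|P_j$. If $\mathcal{F}_F\neq\emptyset$, then, for all sufficiently small $R>0$, the error-bound condition holds for $F$ with $$K_F=\max_{j\in\{1,\dots,k\}:\,P_j\cap\mathcal{F}_F\neq\emptyset}H(I-F_j|P_j),$$ that is, for all $x\in\mathbb{R}^n$, $\operatorname{dist}(x,\mathcal{F}_F)\le R$ implies $\operatorname{dist}(x,\mathcal{F}_F)\le K_F\,\|F(x)-x\|$.
   Context: $\|\cdot\|$ is the Euclidean norm, $\operatorname{dist}(x,S)=\inf_{y\in S}\|x-y\|$, $I$ is the identity, and $\mathcal{F}_F:=\{x\in\mathbb{R}^n:F(x)=x\}$. Compatible collection: for nonempty polyhedra $P_1,\dots,P_k\subseteq\mathbb{R}^n$ and affine operators $F_i:\mathbb{R}^n\to\mathbb{R}^n$, $i=1,\dots,k$, the collection $(F_1,P_1),\dots,(F_k,P_k)$ is compatible if (i) $\mathbb{R}^n=P_1\cup\dots\cup P_k$ and (ii) $F_i(x)=F_j(x)$ for all $i,j$ and all $x\in P_i\cap P_j$. In that case $\bigcup_{i=1}^kF_i|P_i$ denotes the (well-defined) piecewise linear operator that maps $x\in P_i$ to $F_i(x)$. Relative Hoffman constant: for a polyhedron $P\subseteq\mathbb{R}^n$ and an affine operator $G$ with $G^{-1}(0)\cap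 P\neq\emptyset$, where $G^{-1}(0)=\{x:G(x)=0\}$, $$H(G|P):=\sup_{x\in P\setminus G^{-1}(0)}\frac{\operatorname{dist}(x,G^{-1}(0)\cap P)}{\|G(x)\|},$$ which is finite by Hoffman's Lemma, with the convention $H(G|P)=0$ when $P\subseteq G^{-1}(0)$. *)

theory Defs
  imports "HOL-Analysis.Analysis"
begin

definition affine_operator :: "('a::real_vector \<Rightarrow> 'b::real_vector) \<Rightarrow> bool" where
  "affine_operator f \<longleftrightarrow> (\<exists>L c. linear L \<and> f = (\<lambda>x. L x + c))"

definition fixed_point_set :: "('a \<Rightarrow> 'a) \<Rightarrow> 'a set" where
  "fixed_point_set f = {x. f x = x}"

definition compatible_collection ::
    "nat \<Rightarrow> (nat \<Rightarrow> 'a \<Rightarrow> 'b) \<Rightarrow> (nat \<Rightarrow> 'a set) \<Rightarrow> bool" where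
  "compatible_collection k F P \<longleftrightarrow>
     (\<Union>i\<in>{1..k}. P i) = UNIV \<and>
     (\<forall>i\<in>{1..k}. \<forall>j\<in>{1..k}. \<forall>x\<in>P i \<inter> P j. F i x = F j x)"

definition piecewise_operator ::
    "nat \<Rightarrow> (nat \<Rightarrow> 'a \<Rightarrow> 'b) \<Rightarrow> (nat \<Rightarrow> 'a set) \<Rightarrow> 'a \<Rightarrow> 'b" where
  "piecewise_operator k F P x = (THE y. \<exists>i\<in>{1..k}. x \<in> P i \<and> y = F i x)"

lemma piecewise_operator_eq:
  assumes "compatible_collection k F P" "i \<in> {1..k}" "x \<in> P i"
  shows "piecewise_operator k F P x = F i x"
  unfolding piecewise_operator_def
proof (rule the_equality)
  show "\<exists>j\<in>{1..k}. x \<in> P j \<and> F i x = F j x"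
    using assms(2,3) by blast
next
  fix y
  assume "\<exists>j\<in>{1..k}. x \<in> P j \<and> y = F j x"
  then obtain j where "j \<in> {1..k}" "x \<in> P j" "y = F j x"
    by blast
  with assms show "y = F i x"
    unfolding compatible_collection_def by (metis IntI)
qed

(* The supremum is taken in the reals, where Sup is unspecified for sets that are not bounded
   above. For a polyhedron P and an affine operator G with a zero in P the ratios are bounded
   (Hoffman's Lemma), so the definition is meaningful exactly in that setting. The separate
   case is needed because Sup is also unspecified for the empty set. *)
definition relative_hoffman ::
    "('a::euclidean_space \<Rightarrow> 'b::real_normed_vector) \<Rightarrow> 'a set \<Rightarrow> real" where
  "relative_hoffman G P =
     (if P \<subseteq> G -` {0} then 0
      else SUP x\<in>P - G -` {0}. infdist x (G -` {0} \<inter> P) / norm (G x))"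

end

theory Submission
  imports Defs
begin

text \<open>
On a single piece \<open>P j\<close> the residual of \<open>F\<close> is the affine map \<open>x - Fs j x\<close>, and the fixed points
of \<open>F\<close> in \<open>P j\<close> are exactly the zeros of that map in \<open>P j\<close>. When \<open>P j\<close> contains a fixed point,
Hoffman's lemma makes the ratios in \<open>relative_hoffman\<close> bounded, so their supremum is a valid error
constant for \<open>x \<in> P j\<close> (\<open>infdist_le_relative_hoffman\<close>); passing from the fixed points in \<open>P j\<close> to
all fixed points only decreases the distance. It remains to exclude points of pieces without
fixed points. The fixed point set is a finite union of polyhedra, and disjoint polyhedra have
positive distance (\<open>disjoint_polyhedra_positive_distance\<close>), so a small enough \<open>R\<close> forces every \<open>x\<close>
within \<open>R\<close> of a fixed point to lie only in pieces that meet the fixed point set.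

Both facts on polyhedra rest on the closedness of finitely generated cones. For Hoffman's lemma
(\<open>hoffman_bound\<close>), let \<open>p\<close> be the point of the polyhedron closest to \<open>x\<close>. By Farkas, \<open>x - p\<close> lies in
the cone generated by the normals \<open>a\<close> of the constraints active at \<open>p\<close>, and each of them satisfies
\<open>a \<bullet> (x - p) \<le> r\<close> if \<open>x\<close> violates no constraint by more than \<open>r\<close>. Writing \<open>x - p\<close> as a nonnegative
combination of these normals whose coefficients sum to at most \<open>C * norm (x - p)\<close> gives
\<open>(norm (x - p))\<^sup>2 \<le> C * norm (x - p) * r\<close>. For the distance of disjoint polyhedra, Farkas's lemma
applied to the infeasible joint system produces a strongly separating hyperplane.
\<close>

section \<open>Finite systems of linear inequalities\<close>

text \<open>
A pair \<open>(a, b)\<close> stands for the inequality \<open>a \<bullet> x \<le> b\<close>. Keeping the right-hand side in the pair lets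
the constraints themselves generate a cone in the product space, as Farkas's lemma needs.
Zero normals are allowed, since a coordinate of an affine map may be constant.
\<close>

definition solution_set :: "('a::euclidean_space \<times> real) set \<Rightarrow> 'a set" where
  "solution_set W = {x. \<forall>w\<in>W. fst w \<bullet> x \<le> snd w}"

lemma polyhedron_solution_set:
  assumes "polyhedron S"
  obtains W where "finite W" "S = solution_set W"
proof -
  obtain F where F: "finite F" "S = \<Inter>F" "\<forall>h\<in>F. \<exists>a b. a \<noteq> 0 \<and> h = {x. a \<bullet> x \<le> b}"
    using assms unfolding polyhedron_def by blast
  then have "\<forall>h\<in>F. \<exists>w. h = {x. fst w \<bullet> x \<le> snd w}"
    by (metis fst_conv snd_conv)
  then obtain w where w: "\<And>h. h \<in> F \<Longrightarrow> h = {x. fst (w h) \<bullet> x \<le> snd (w h)}"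
    by metis
  then have "S = solution_set (w ` F)"
    unfolding solution_set_def F(2) by blast
  then show ?thesis
    using that F(1) by blast
qed

lemma solution_set_Un: "solution_set (V \<union> W) = solution_set V \<inter> solution_set W"
  by (auto simp: solution_set_def)

lemma closed_solution_set: "closed (solution_set W)"
proof -
  have "solution_set W = (\<Inter>w\<in>W. {x. fst w \<bullet> x \<le> snd w})"
    by (auto simp: solution_set_def)
  then show ?thesis
    by (simp add: closed_INT closed_halfspace_le)
qed

lemma convex_solution_set: "convex (solution_set W)"
proof -
  have "solution_set W = (\<Inter>w\<in>W. {x. fst w \<bullet> x \<le> snd w})"
    by (auto simp: solution_set_def)
  then show ?thesis
    by (simp add: convex_INT convex_halfspace_le)
qed

section \<open>Finitely generated cones\<close>

text \<open>
This says in substance that each \<open>y\<close> in the cone has a representation by the generators with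
nonnegative coefficients of sum at most \<open>C * norm y\<close>, phrased by duality so that no coefficients
have to be handled. For a single \<open>y\<close> some constant exists because the vectors that have one form
a convex cone. Uniformity comes from the finitely many points whose convex hull is the polytope cut out of the cone
by a box containing the unit ball, and then from scaling.
\<close>

lemma convex_cone_hull_finite_inner_bound:
  fixes A :: "'a::euclidean_space set"
  assumes "finite A"
  shows "\<exists>C\<ge>0. \<forall>y\<in>convex_cone hull A. \<forall>w r. 0 \<le> r \<longrightarrow> (\<forall>a\<in>A. a \<bullet> w \<le> r) \<longrightarrow>
           y \<bullet> w \<le> C * norm y * r"
proof -
  let ?K = "convex_cone hull A"
  define adm where "adm = {(w::'a, r). 0 \<le> r \<and> (\<forall>a\<in>A. a \<bullet> w \<le> r)}"
  \<comment> \<open>\<open>adm\<close> consists of the test vectors \<open>w\<close> together with a common bound \<open>r\<close> on all generators.\<close>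
  have "?K \<subseteq> {y. \<exists>c\<ge>0. \<forall>(w, r)\<in>adm. y \<bullet> w \<le> c * r}"
  proof (rule hull_minimal)
    show "A \<subseteq> {y. \<exists>c\<ge>0. \<forall>(w, r)\<in>adm. y \<bullet> w \<le> c * r}"
      by (auto simp: adm_def intro!: exI[of _ 1])
    show "convex_cone {y. \<exists>c\<ge>0. \<forall>(w, r)\<in>adm. y \<bullet> w \<le> c * r}"
      unfolding convex_cone_iff
    proof (safe)
      show "\<exists>c\<ge>0. \<forall>(w, r)\<in>adm. 0 \<bullet> w \<le> c * r"
        by (auto intro!: exI[of _ 0])
    next
      fix x y c d
      assume "0 \<le> (c::real)" "\<forall>(w, r)\<in>adm. x \<bullet> w \<le> c * r"
        "0 \<le> (d::real)" "\<forall>(w, r)\<in>adm. y \<bullet> w \<le> d * r"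
      then show "\<exists>c\<ge>0. \<forall>(w, r)\<in>adm. (x + y) \<bullet> w \<le> c * r"
        by (intro exI[of _ "c + d"]) (auto simp: inner_add_left distrib_right intro!: add_mono)
    next
      fix x c d
      assume "0 \<le> (c::real)" "\<forall>(w, r)\<in>adm. x \<bullet> w \<le> c * r" "0 \<le> (d::real)"
      then show "\<exists>c\<ge>0. \<forall>(w, r)\<in>adm. (d *\<^sub>R x) \<bullet> w \<le> c * r"
        by (intro exI[of _ "d * c"]) (auto simp: mult.assoc intro!: mult_left_mono)
    qed
  qed
  then have "\<forall>y\<in>?K. \<exists>c. 0 \<le> c \<and> (\<forall>(w, r)\<in>adm. y \<bullet> w \<le> c * r)"
    by blast
  then obtain c where c: "\<And>y. y \<in> ?K \<Longrightarrow> 0 \<le> c y \<and> (\<forall>(w, r)\<in>adm. y \<bullet> w \<le> c y * r)"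
    unfolding bchoice_iff by blast
  have "polytope (?K \<inter> cbox (- One) One)"
    unfolding polytope_eq_bounded_polyhedron
    using polyhedron_convex_cone_hull[OF assms] by (simp add: bounded_Int)
  then obtain V where V: "finite V" "?K \<inter> cbox (- One) One = convex hull V"
    unfolding polytope_def by blast
  have VK: "V \<subseteq> ?K"
    using V(2) hull_subset[of V convex] by blast
  define C where "C = (\<Sum>v\<in>V. c v)"
  have C0: "0 \<le> C"
    unfolding C_def using VK c by (auto intro!: sum_nonneg)
  have VC: "convex hull V \<subseteq> {y. y \<bullet> w \<le> C * r}" if wr: "(w, r) \<in> adm" for w r
  proof (rule hull_minimal)
    show "V \<subseteq> {y. y \<bullet> w \<le> C * r}"
    proof safe
      fix v assume v: "v \<in> V"
      then have "c v \<le> C"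
        unfolding C_def using V(1) VK c by (intro member_le_sum) auto
      moreover have "v \<bullet> w \<le> c v * r" "0 \<le> r"
        using c[of v] v VK wr by (auto simp: adm_def)
      ultimately show "v \<bullet> w \<le> C * r"
        using mult_right_mono[of "c v" C r] by linarith
    qed
    show "convex {y. y \<bullet> w \<le> C * r}"
      using convex_halfspace_le[of w "C * r"] by (simp add: inner_commute)
  qed
  have "y \<bullet> w \<le> C * norm y * r" if y: "y \<in> ?K" and wr: "(w, r) \<in> adm" for y w r
  proof (cases "y = 0")
    case False
    let ?u = "inverse (norm y) *\<^sub>R y"
    have "?u \<in> ?K"
      using y by (simp add: convex_cone_hull_mul)
    moreover have "?u \<in> cbox (- One) One"
    proof -
      have "\<bar>?u \<bullet> i\<bar> \<le> 1" if "i \<in> Basis" for i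
        using Basis_le_norm[OF that, of ?u] False by simp
      then show ?thesis
        unfolding mem_box by (force simp: abs_le_iff)
    qed
    ultimately have "?u \<bullet> w \<le> C * r"
      using VC[OF wr] V(2) by blast
    then show ?thesis
      using False by (simp add: field_simps)
  qed auto
  then show ?thesis
    using C0 unfolding adm_def by blast
qed

text \<open>
Farkas's lemma: a hyperplane that strictly separates a point from the closed cone can be moved
to pass through the origin, since a linear functional bounded below on a cone is nonnegative there.
\<close>

lemma convex_cone_hull_separation:
  fixes A :: "'a::euclidean_space set"
  assumes "finite A" "y \<notin> convex_cone hull A"
  obtains d where "\<And>a. a \<in> A \<Longrightarrow> d \<bullet> a \<le> 0" "0 < d \<bullet> y"
proof -
  let ?K = "convex_cone hull A"
  obtain a b where ab: "a \<bullet> y < b" "\<And>x. x \<in> ?K \<Longrightarrow> b < a \<bullet> x"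
    using separating_hyperplane_closed_point[OF convex_convex_cone_hull
        closed_convex_cone_hull[OF assms(1)] assms(2)] by blast
  have b: "b < 0"
    using ab(2)[OF convex_cone_hull_contains_0] by simp
  have "0 \<le> a \<bullet> x" if "x \<in> A" for x
  proof (rule ccontr)
    assume neg: "\<not> 0 \<le> a \<bullet> x"
    \<comment> \<open>This positive multiple of \<open>x\<close> lies in the cone, yet the functional \<open>a\<close> takes the value \<open>b\<close> there.\<close>
    have "(b / (a \<bullet> x)) *\<^sub>R x \<in> ?K"
      using that neg b by (intro convex_cone_hull_mul hull_inc) (auto simp: divide_nonpos_neg)
    from ab(2)[OF this] neg show False
      by simp
  qed
  then show ?thesis
    using that[of "- a"] ab(1) b by force
qed

section \<open>Hoffman's lemma\<close>

text \<open>
This is the optimality condition of the projection \<open>p\<close> of \<open>x\<close>. If \<open>x - p\<close> were outside the cone, Farkas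
would give a direction \<open>d\<close> that violates no active constraint and makes an acute angle with \<open>x - p\<close>.
A short step along \<open>d\<close> also keeps the inactive constraints, so it stays feasible and brings
\<open>p\<close> closer to \<open>x\<close>.
\<close>

lemma residual_in_active_cone:
  fixes W :: "('a::euclidean_space \<times> real) set"
  assumes W: "finite W" and p: "p \<in> solution_set W"
    and closest: "\<And>z. z \<in> solution_set W \<Longrightarrow> dist x p \<le> dist x z"
  shows "x - p \<in> convex_cone hull (fst ` {w\<in>W. fst w \<bullet> p = snd w})"
proof (rule ccontr)
  assume outside: "\<not> ?thesis"
  have finite_active: "finite (fst ` {w\<in>W. fst w \<bullet> p = snd w})"
    using W by simp
  obtain d where active: "\<And>a. a \<in> fst ` {w\<in>W. fst w \<bullet> p = snd w} \<Longrightarrow> d \<bullet> a \<le> 0"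
    and d: "0 < d \<bullet> (x - p)"
    using convex_cone_hull_separation[OF finite_active outside] by blast
  have "\<forall>\<^sub>F t in at_right (0::real). \<forall>w\<in>W. fst w \<bullet> (p + t *\<^sub>R d) \<le> snd w"
  proof (rule eventually_ball_finite[OF W], safe)
    fix a b assume w: "(a, b) \<in> W"
    show "\<forall>\<^sub>F t in at_right (0::real). fst (a, b) \<bullet> (p + t *\<^sub>R d) \<le> snd (a, b)"
    proof (cases "a \<bullet> p = b")
      case True
      then have "d \<bullet> a \<le> 0"
        using w by (intro active) force
      then have "fst (a, b) \<bullet> (p + t *\<^sub>R d) \<le> snd (a, b)" if "0 < t" for t
        using True that by (simp add: inner_add_right inner_commute[of d] mult_nonneg_nonpos)
      then show ?thesis
        using eventually_at_right_less[of "0::real"] by (rule eventually_mono[rotated])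
    next
      case False
      then have "a \<bullet> p < b"
        using p w by (force simp: solution_set_def)
      moreover have "((\<lambda>t. a \<bullet> (p + t *\<^sub>R d)) \<longlongrightarrow> a \<bullet> (p + 0 *\<^sub>R d)) (at_right 0)"
        by (intro tendsto_intros)
      ultimately have "\<forall>\<^sub>F t in at_right 0. a \<bullet> (p + t *\<^sub>R d) < b"
        by (intro order_tendstoD) auto
      then show ?thesis
        by (rule eventually_mono) simp
    qed
  qed
  then have "\<forall>\<^sub>F t in at_right (0::real). 0 < t \<and> p + t *\<^sub>R d \<in> solution_set W"
    using eventually_at_right_less[of "0::real"]
    by eventually_elim (auto simp: solution_set_def)
  then obtain t where t: "0 < t" "p + t *\<^sub>R d \<in> solution_set W"
    using eventually_happens' trivial_limit_at_right_real by blast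
  have "(x - p) \<bullet> (p + t *\<^sub>R d - p) \<le> 0"
    using any_closest_point_dot[OF convex_solution_set closed_solution_set p t(2)] closest by blast
  then show False
    using t(1) d by (simp add: inner_commute mult_le_0_iff)
qed

text \<open>
The set of constraints active at the projection of \<open>x\<close> depends on \<open>x\<close>, but there are only finitely
many such sets; the sum of the corresponding cone constants serves for all of them.
\<close>

theorem hoffman_bound:
  fixes W :: "('a::euclidean_space \<times> real) set"
  assumes W: "finite W" and ne: "solution_set W \<noteq> {}"
  shows "\<exists>C\<ge>0. \<forall>x. \<forall>r\<ge>0. (\<forall>w\<in>W. fst w \<bullet> x \<le> snd w + r) \<longrightarrow> infdist x (solution_set W) \<le> C * r"
proof -
  let ?bound = "\<lambda>A C. 0 \<le> C \<and> (\<forall>y\<in>convex_cone hull A. \<forall>w r. 0 \<le> r \<longrightarrow> (\<forall>a\<in>A. a \<bullet> w \<le> r) \<longrightarrow>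
           y \<bullet> w \<le> C * norm y * r)"
  have "\<exists>C. ?bound A C" if "A \<in> Pow (fst ` W)" for A
    using convex_cone_hull_finite_inner_bound[of A] finite_subset[of A "fst ` W"] W that by auto
  then obtain c where c: "\<And>A. A \<in> Pow (fst ` W) \<Longrightarrow> ?bound A (c A)"
    by metis
  define C where "C = (\<Sum>A\<in>Pow (fst ` W). c A)"
  have C0: "0 \<le> C"
    unfolding C_def using c by (intro sum_nonneg) blast
  have "infdist x (solution_set W) \<le> C * r"
    if r: "0 \<le> r" and x: "\<forall>w\<in>W. fst w \<bullet> x \<le> snd w + r" for x r
  proof -
    obtain p where p: "p \<in> solution_set W" "infdist x (solution_set W) = dist x p"
      using infdist_attains_inf[OF closed_solution_set ne] by metis
    define A where "A = fst ` {w\<in>W. fst w \<bullet> p = snd w}"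
    have A: "A \<in> Pow (fst ` W)"
      unfolding A_def by blast
    have cC: "c A \<le> C"
      unfolding C_def using W A c by (intro member_le_sum) auto
    have "x - p \<in> convex_cone hull A"
      unfolding A_def using W p by (intro residual_in_active_cone) (metis infdist_le)+
    moreover have "\<forall>a\<in>A. a \<bullet> (x - p) \<le> r"
      using x unfolding A_def by (force simp: inner_diff_right)
    ultimately have "(x - p) \<bullet> (x - p) \<le> c A * norm (x - p) * r"
      using c[OF A] r by blast
    also have "\<dots> \<le> C * norm (x - p) * r"
      using cC r by (intro mult_right_mono) auto
    finally have "norm (x - p) * norm (x - p) \<le> norm (x - p) * (C * r)"
      by (simp add: dot_square_norm power2_eq_square mult_ac)
    then have "norm (x - p) \<le> C * r"
      using C0 r by (cases "x = p") auto
    then show ?thesis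
      using p(2) by (simp add: dist_norm)
  qed
  then show ?thesis
    using C0 by blast
qed

section \<open>The relative Hoffman constant\<close>

text \<open>
Splitting \<open>G x = 0\<close> into two inequalities per coordinate gives a system whose violation at any \<open>x\<close>
is at most \<open>norm (G x)\<close>. This turns Hoffman's bound into one in terms of the residual.
\<close>

lemma zero_set_solution_set:
  fixes G :: "'a::euclidean_space \<Rightarrow> 'b::euclidean_space"
  assumes "affine_operator G"
  obtains W where "finite W" "G -` {0} = solution_set W"
    "\<And>x w. w \<in> W \<Longrightarrow> fst w \<bullet> x \<le> snd w + norm (G x)"
proof -
  obtain L c where L: "linear L" and G: "\<And>x. G x = L x + c"
    using assms unfolding affine_operator_def by metis
  define W where "W = (\<lambda>i. (adjoint L i, - (c \<bullet> i))) ` Basis \<union>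
    (\<lambda>i. (- adjoint L i, c \<bullet> i)) ` Basis"
  have row: "adjoint L i \<bullet> x = G x \<bullet> i - c \<bullet> i" for i x
    using adjoint_works[OF L, of x i] by (simp add: G inner_add_left inner_commute[of "adjoint L i"])
  have "finite W"
    by (simp add: W_def)
  moreover have "G -` {0} = solution_set W"
  proof -
    have "G x = 0 \<longleftrightarrow> (\<forall>i\<in>Basis. G x \<bullet> i \<le> 0 \<and> 0 \<le> G x \<bullet> i)" for x
      unfolding euclidean_eq_iff[where 'a='b] by (auto intro: antisym)
    then show ?thesis
      by (simp add: W_def solution_set_def ball_Un row vimage_def ball_conj_distrib)
  qed
  moreover have "fst w \<bullet> x \<le> snd w + norm (G x)" if "w \<in> W" for x w
  proof -
    have "G x \<bullet> i \<le> norm (G x) \<and> - (G x \<bullet> i) \<le> norm (G x)" if "i \<in> Basis" for i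
      using Basis_le_norm[OF that, of "G x"] by linarith
    then show ?thesis
      using that by (auto simp: W_def row)
  qed
  ultimately show ?thesis
    using that by blast
qed

text \<open>
Hoffman's lemma for the joint system of \<open>P\<close> and \<open>G x = 0\<close> shows that the ratios are bounded on \<open>P\<close>,
where only the equations can be violated. Hence the supremum in \<open>relative_hoffman\<close> is a genuine
least upper bound.
\<close>

lemma infdist_le_relative_hoffman:
  fixes G :: "'a::euclidean_space \<Rightarrow> 'b::euclidean_space"
  assumes P: "polyhedron P" and G: "affine_operator G"
    and ne: "G -` {0} \<inter> P \<noteq> {}" and x: "x \<in> P"
  shows "infdist x (G -` {0} \<inter> P) \<le> relative_hoffman G P * norm (G x)"
proof (cases "G x = 0")
  case True
  then show ?thesis
    using x by simp
next
  case False
  obtain V where V: "finite V" "P = solution_set V"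
    using polyhedron_solution_set[OF P] .
  obtain W where W: "finite W" "G -` {0} = solution_set W"
    "\<And>x w. w \<in> W \<Longrightarrow> fst w \<bullet> x \<le> snd w + norm (G x)"
    using zero_set_solution_set[OF G] by blast
  have S: "G -` {0} \<inter> P = solution_set (W \<union> V)"
    using V(2) W(2) by (simp add: solution_set_Un)
  obtain C where C: "\<And>z r. 0 \<le> r \<Longrightarrow> \<forall>w\<in>W \<union> V. fst w \<bullet> z \<le> snd w + r \<Longrightarrow>
      infdist z (G -` {0} \<inter> P) \<le> C * r"
    using hoffman_bound[of "W \<union> V"] V(1) W(1) ne unfolding S by auto
  have bound: "infdist z (G -` {0} \<inter> P) \<le> C * norm (G z)" if "z \<in> P" for z
  proof (rule C)
    have "fst w \<bullet> z \<le> snd w + norm (G z)" if "w \<in> V" for w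
    proof -
      have "fst w \<bullet> z \<le> snd w"
        using \<open>z \<in> P\<close> that V(2) by (simp add: solution_set_def)
      then show ?thesis
        by (simp add: add_increasing2)
    qed
    then show "\<forall>w\<in>W \<union> V. fst w \<bullet> z \<le> snd w + norm (G z)"
      using W(3) by blast
  qed simp
  let ?q = "\<lambda>z. infdist z (G -` {0} \<inter> P) / norm (G z)"
  have "bdd_above (?q ` (P - G -` {0}))"
    using bound by (intro bdd_aboveI2[where M = C]) (auto simp: pos_divide_le_eq)
  then have "?q x \<le> (SUP z\<in>P - G -` {0}. ?q z)"
    using x False by (intro cSUP_upper) auto
  also have "\<dots> = relative_hoffman G P"
    using x False by (auto simp: relative_hoffman_def)
  finally show ?thesis
    using False by (simp add: pos_divide_le_eq)
qed

section \<open>Disjoint polyhedra\<close>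

lemma convex_cone_hull_valid_inequality:
  assumes "(c, s) \<in> convex_cone hull W" "x \<in> solution_set W"
  shows "c \<bullet> x \<le> s"
proof -
  have "convex_cone hull W \<subseteq> {w. fst w \<bullet> x \<le> snd w}"
    using assms(2)
    by (intro hull_minimal)
      (auto simp: solution_set_def convex_cone_iff inner_add_left intro: add_mono mult_left_mono)
  then show ?thesis
    using assms(1) by auto
qed

text \<open>
The infeasibility of the joint system is certified by deriving \<open>0 \<bullet> x \<le> - 1\<close> as a nonnegative
combination of its inequalities. Splitting the combination into the parts that belong to \<open>P\<close> and to
\<open>Q\<close> yields \<open>c \<bullet> x \<le> s\<close> on \<open>P\<close> and \<open>c \<bullet> y \<ge> s + 1\<close> on \<open>Q\<close>, so the polyhedra are at least
\<open>1 / (norm c + 1)\<close> apart; the added 1 covers \<open>c = 0\<close>.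
\<close>

lemma disjoint_polyhedra_positive_distance:
  fixes P Q :: "'a::euclidean_space set"
  assumes "polyhedron P" "polyhedron Q" "P \<inter> Q = {}"
  obtains \<delta> where "0 < \<delta>" "\<And>x y. x \<in> P \<Longrightarrow> y \<in> Q \<Longrightarrow> \<delta> \<le> dist x y"
proof -
  obtain V where V: "finite V" "P = solution_set V"
    using polyhedron_solution_set[OF assms(1)] .
  obtain W where W: "finite W" "Q = solution_set W"
    using polyhedron_solution_set[OF assms(2)] .
  have "(0, - 1) \<in> convex_cone hull (V \<union> W)"
  proof (rule ccontr)
    assume "\<not> ?thesis"
    then obtain d where d: "\<And>w. w \<in> V \<union> W \<Longrightarrow> d \<bullet> w \<le> 0" "0 < d \<bullet> (0, - 1)"
      using convex_cone_hull_separation[of "V \<union> W"] V(1) W(1) by blast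
    obtain z t where zt: "d = (z, t)"
      by fastforce
    have t: "t < 0"
      using d(2) by (simp add: zt)
    \<comment> \<open>Normalising the last component of the separating functional to \<open>- 1\<close> gives a common point.\<close>
    have "(inverse (- t)) *\<^sub>R z \<in> solution_set (V \<union> W)"
      unfolding solution_set_def
    proof (rule CollectI, rule ballI)
      fix w assume "w \<in> V \<union> W"
      from d(1)[OF this] have "fst w \<bullet> z \<le> - t * snd w"
        by (simp add: zt inner_prod_def inner_commute)
      then show "fst w \<bullet> (inverse (- t) *\<^sub>R z) \<le> snd w"
        using t by (simp add: field_simps)
    qed
    then show False
      using assms(3) V(2) W(2) unfolding solution_set_Un by blast
  qed
  then obtain u v where uv: "u \<in> convex_cone hull V" "v \<in> convex_cone hull W" "u + v = (0, - 1)"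
    unfolding convex_cone_hull_Un by auto
  obtain c s where u: "u = (c, s)"
    by fastforce
  have v: "v = (- c, - 1 - s)"
    using uv(3) u by (cases v) (auto simp: add_eq_0_iff algebra_simps)
  have "1 / (norm c + 1) \<le> dist x y" if "x \<in> P" "y \<in> Q" for x y
  proof -
    have "c \<bullet> x \<le> s"
      using convex_cone_hull_valid_inequality[of c s V x] uv(1) u V(2) that by simp
    moreover have "- c \<bullet> y \<le> - 1 - s"
      using convex_cone_hull_valid_inequality[of "- c" "- 1 - s" W y] uv(2) v W(2) that by simp
    ultimately have "1 \<le> c \<bullet> (y - x)"
      by (simp add: inner_diff_right)
    also have "\<dots> \<le> norm c * dist x y"
      using norm_cauchy_schwarz[of c "y - x"] by (simp add: dist_norm norm_minus_commute)
    also have "\<dots> \<le> (norm c + 1) * dist x y"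
      by (simp add: mult_right_mono)
    finally show ?thesis
      by (simp add: pos_divide_le_eq add_nonneg_pos mult.commute)
  qed
  then show ?thesis
    using that[of "1 / (norm c + 1)"] by (simp add: add_nonneg_pos)
qed

section \<open>The error bound\<close>

lemma affine_operator_residual:
  assumes "affine_operator f"
  shows "affine_operator (\<lambda>x. x - f x)"
proof -
  obtain L c where "linear L" "f = (\<lambda>x. L x + c)"
    using assms unfolding affine_operator_def by blast
  then show ?thesis
    unfolding affine_operator_def
    by (intro exI[of _ "\<lambda>x. x - L x"] exI[of _ "- c"])
      (auto intro: linear_compose_sub linear_ident)
qed

lemma polyhedron_zero_set:
  fixes G :: "'a::euclidean_space \<Rightarrow> 'b::euclidean_space"
  assumes "affine_operator G"
  shows "polyhedron (G -` {0})"
proof -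
  obtain L c where L: "linear L" and G: "\<And>x. G x = L x + c"
    using assms unfolding affine_operator_def by metis
  have "affine (G -` {0})"
  proof (clarsimp simp: affine_def G)
    fix x y and u v :: real
    assume xy: "L x + c = 0" "L y + c = 0" and uv: "u + v = 1"
    have "L (u *\<^sub>R x + v *\<^sub>R y) + c = u *\<^sub>R (L x + c) + v *\<^sub>R (L y + c)"
      using uv by (simp add: linear_add[OF L] linear_scale[OF L] algebra_simps
          flip: scaleR_add_left)
    then show "L (u *\<^sub>R x + v *\<^sub>R y) + c = 0"
      by (simp add: xy)
  qed
  then show ?thesis
    by (rule affine_imp_polyhedron)
qed

text \<open>
It suffices that \<open>R\<close> lies below the distance between any piece without fixed points and any of the
polyhedra that make up the fixed point set: then
a piece containing \<open>x\<close> is one of those over which \<open>K\<close> is the maximum.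
\<close>

theorem theorem4:
  fixes P :: "nat \<Rightarrow> (real ^ 'n) set"
    and Fs :: "nat \<Rightarrow> real ^ 'n \<Rightarrow> real ^ 'n"
    and F :: "real ^ 'n \<Rightarrow> real ^ 'n"
    and k :: nat and K :: real
  assumes "\<And>j. j \<in> {1..k} \<Longrightarrow> polyhedron (P j) \<and> P j \<noteq> {}"
    and "\<And>j. j \<in> {1..k} \<Longrightarrow> affine_operator (Fs j)"
    and "compatible_collection k Fs P"
    and "F = piecewise_operator k Fs P"
    and "fixed_point_set F \<noteq> {}"
    and "K = Max ((\<lambda>j. relative_hoffman (\<lambda>x. x - Fs j x) (P j)) `
                   {j \<in> {1..k}. P j \<inter> fixed_point_set F \<noteq> {}})"
  shows "\<forall>\<^sub>F R in at_right 0. \<forall>x. infdist x (fixed_point_set F) \<le> R \<longrightarrow>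
           infdist x (fixed_point_set F) \<le> K * norm (F x - x)"
proof -
  let ?Fix = "fixed_point_set F"
  let ?G = "\<lambda>j x. x - Fs j x"
  let ?J = "{j \<in> {1..k}. P j \<inter> ?Fix \<noteq> {}}"
  define Z where "Z j = ?G j -` {0} \<inter> P j" for j
  have F_on: "F x = Fs j x" if "j \<in> {1..k}" "x \<in> P j" for j x
    using piecewise_operator_eq[OF assms(3) that] assms(4) by simp
  have cover: "\<exists>j\<in>{1..k}. x \<in> P j" for x
    using assms(3) unfolding compatible_collection_def by blast
  have Z: "P j \<inter> ?Fix = Z j" if "j \<in> {1..k}" for j
    using F_on[OF that] by (auto simp: Z_def fixed_point_set_def)
  have Fix: "?Fix = (\<Union>j\<in>{1..k}. Z j)"
    using Z cover by blast
  have G: "affine_operator (?G j)" if "j \<in> {1..k}" for j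
    using affine_operator_residual assms(2)[OF that] .
  have polyZ: "polyhedron (Z j)" if "j \<in> {1..k}" for j
    unfolding Z_def using polyhedron_zero_set[OF G[OF that]] assms(1)[OF that] by simp
  have closed: "closed ?Fix"
    unfolding Fix using polyZ by (intro closed_UN) (auto simp: polyhedron_imp_closed)
  have "\<forall>\<^sub>F R in at_right 0. \<forall>j\<in>{1..k} - ?J. \<forall>i\<in>{1..k}. \<forall>x\<in>P j. \<forall>y\<in>Z i. R < dist x y"
  proof (rule eventually_ball_finite[OF _ ballI], simp, rule eventually_ball_finite[OF _ ballI], simp)
    fix j i assume j: "j \<in> {1..k} - ?J" and i: "i \<in> {1..k}"
    have "P j \<inter> Z i = {}"
      using j i Fix by blast
    then obtain \<delta> where "0 < \<delta>" "\<And>x y. x \<in> P j \<Longrightarrow> y \<in> Z i \<Longrightarrow> \<delta> \<le> dist x y"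
      using disjoint_polyhedra_positive_distance[of "P j" "Z i"] assms(1)[of j] polyZ[OF i] j by blast
    then show "\<forall>\<^sub>F R in at_right 0. \<forall>x\<in>P j. \<forall>y\<in>Z i. R < dist x y"
      by (intro eventually_at_rightI[of 0 \<delta>]) fastforce+
  qed
  then show ?thesis
  proof (rule eventually_mono, intro allI impI)
    fix R x
    assume far: "\<forall>j\<in>{1..k} - ?J. \<forall>i\<in>{1..k}. \<forall>x\<in>P j. \<forall>y\<in>Z i. R < dist x y"
      and near: "infdist x ?Fix \<le> R"
    obtain j where j: "j \<in> {1..k}" "x \<in> P j"
      using cover by blast
    obtain y where y: "y \<in> ?Fix" "infdist x ?Fix = dist x y"
      using infdist_attains_inf[OF closed assms(5)] by metis
    have J: "j \<in> ?J"
    proof (rule ccontr)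
      assume "j \<notin> ?J"
      then have "R < dist x y"
        using far j y(1) unfolding Fix by blast
      then show False
        using near y(2) by simp
    qed
    then have ne: "Z j \<noteq> {}"
      using Z[OF j(1)] by blast
    have "infdist x ?Fix \<le> infdist x (Z j)"
      using ne Fix j(1) by (intro infdist_mono) auto
    also have "\<dots> \<le> relative_hoffman (?G j) (P j) * norm (?G j x)"
      using infdist_le_relative_hoffman[OF _ G[OF j(1)], of "P j" x] assms(1)[OF j(1)] ne j(2)
      unfolding Z_def by blast
    also have "\<dots> \<le> K * norm (?G j x)"
      unfolding assms(6) using J by (intro mult_right_mono Max_ge) auto
    also have "\<dots> = K * norm (F x - x)"
      using F_on[OF j] by (simp add: norm_minus_commute)
    finally show "infdist x ?Fix \<le> K * norm (F x - x)" .
  qed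
qed

end
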